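(* Let $d, N \in \mathbb{N}$. Suppose that $\sigma: \mathbb{R} \to \mathbb{R}$ is a continuous and non-polynomial function, $\Omega \subset \mathbb{R}^d$ is a bounded open domain, $u_1, \dots, u_N \in C(\bar{\Omega})$, and $g, h \in C(\bar{\Omega})$ are such that $h|_{\partial\Omega} = u_n|_{\partial\Omega}$ for all $n \in \{1, \dots, N\}$, $g|_{\partial\Omega} = 0$, and $g > 0$ on $\Omega$. Then for every $\varepsilon > 0$ there exist $p \in \mathbb{N}$, $\zeta_i \in \mathbb{R}$, $w_i \in \mathbb{R}^d$ and $\beta_n^i \in \mathbb{R}$ ($i = 1, \dots, p$, $n = 1, \dots, N$) such that for all $n \in \{1, \dots, N\}$ and all $y \in \bar{\Omega}$ $$\Big| u_n(y) - \Big( h(y) + g(y) \cdot \sum_{i=1}^p \beta_n^i\, \sigma(w_i \cdot y + \zeta_i) \Big) \Big| < \varepsilon.$$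
   Context: $C(\bar{\Omega})$ denotes the space of real-valued continuous functions on the closure $\bar{\Omega}$, $\partial\Omega$ is the topological boundary of $\Omega$, and $w \cdot y$ is the Euclidean inner product on $\mathbb{R}^d$. The parameters $p$, $w_i$, $\zeta_i$ do not depend on $n$; only the coefficients $\beta_n^i$ depend on $n$ (the upper index $i$ is an index, not a power). *)

theory Defs
  imports "HOL-Analysis.Analysis" "HOL-Computational_Algebra.Polynomial"
begin

end

theory Submission
  imports Defs
begin

text \<open>
  The uniform closure \<open>V\<close> of the ridge functions \<open>\<sigma> (w \<bullet> y + b)\<close> on a compact set \<open>K\<close> contains every
  continuous function. Suppose that \<open>V\<close> contains \<open>(v \<bullet> y) ^ k * f (w \<bullet> y + b)\<close> for all \<open>w\<close>, \<open>b\<close>. If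
  \<open>F\<close> is an antiderivative of \<open>f\<close>, Riemann sums put \<open>(v \<bullet> y) ^ k * (F (w \<bullet> y + b + h) - F (w \<bullet> y + b))\<close>
  into \<open>V\<close>, and difference quotients in \<open>w\<close> along \<open>v\<close> then yield the same property for \<open>k + 1\<close> and the
  difference \<open>f (x + h) - f x\<close>; so \<open>\<sigma>\<close> need not be smooth. Starting from \<open>\<sigma>\<close> and taking \<open>w = 0\<close> at the
  end, \<open>(v \<bullet> y) ^ m\<close> lies in \<open>V\<close> unless all \<open>m\<close>-fold differences of \<open>\<sigma>\<close> vanish, which would make \<open>\<sigma>\<close>
  a polynomial. Hence \<open>exp (v \<bullet> y)\<close> lies in \<open>V\<close>, and the exponentials span an algebra to which the
  Stone--Weierstrass theorem applies.

  For the boundary-adapted form, \<open>u n - h\<close> is small wherever \<open>g\<close> is, so it is uniformly close to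
  \<open>g * \<phi>\<close> with \<open>\<phi> = (u n - h) / max g m\<close> for a small constant \<open>m > 0\<close>; the network approximates \<open>\<phi>\<close>.
\<close>

section \<open>Finite differences and polynomials\<close>

lemma pderiv_surj: "\<exists>Q :: real poly. pderiv Q = P"
proof
  let ?Q = "\<Sum>i\<le>degree P. monom (coeff P i / of_nat (Suc i)) (Suc i)"
  show "pderiv ?Q = P"
    using higher_pderiv_sum[of 1 "\<lambda>i. monom (coeff P i / of_nat (Suc i)) (Suc i)" "{..degree P}"]
    by (simp add: pderiv_monom poly_as_sum_of_monoms del: of_nat_Suc)
qed

text \<open>Induction on the degree: an antiderivative of a solution for \<open>pderiv P\<close>
  solves the equation for \<open>P\<close> up to a constant \<open>c\<close>, and
  \<open>[:0, c:]\<close> has unit difference \<open>c\<close>.\<close>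

lemma poly_forward_difference_surj:
  "\<exists>Q :: real poly. \<forall>x. poly Q (x + 1) - poly Q x = poly P x"
proof (induction "degree P" arbitrary: P)
  case 0
  then obtain c where P: "P = [:c:]"
    by (metis degree_eq_zeroE)
  show ?case
    by (rule exI[of _ "[:0, c:]"]) (simp add: P algebra_simps)
next
  case (Suc n)
  have "n = degree (pderiv P)"
    using Suc.hyps(2) by (simp add: degree_pderiv)
  from Suc.hyps(1)[OF this] obtain R where
    R: "\<And>x. poly R (x + 1) - poly R x = poly (pderiv P) x"
    by blast
  obtain S where S: "pderiv S = R"
    using pderiv_surj by blast
  have "((\<lambda>x. poly S (x + 1) - poly S x - poly P x) has_real_derivative 0) (at x)" for x
  proof -
    have "((\<lambda>x. poly S (x + 1) - poly S x - poly P x) has_real_derivative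
            poly R (x + 1) - poly R x - poly (pderiv P) x) (at x)"
      by (auto intro!: derivative_eq_intros DERIV_chain2[OF poly_DERIV] simp: S)
    then show ?thesis by (simp add: R)
  qed
  then obtain c where c: "\<And>x. poly S (x + 1) - poly S x - poly P x = c"
    using DERIV_isconst_all[of "\<lambda>x. poly S (x + 1) - poly S x - poly P x"] by blast
  have "poly (S - [:0, c:]) (x + 1) - poly (S - [:0, c:]) x = poly P x" for x
    using c[of x] by (simp add: algebra_simps)
  then show ?case by blast
qed

text \<open>Subtracting the value at 0 leaves a polynomial that vanishes at every natural number,
  hence has infinitely many roots.\<close>

lemma poly_periodic_const:
  fixes P :: "real poly"
  assumes "\<And>x. poly P (x + 1) = poly P x"
  shows "poly P x = poly P 0"
proof -
  have nat: "poly P (of_nat n) = poly P 0" for n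
  proof (induction n)
    case (Suc n)
    then show ?case using assms[of "of_nat n"] by (simp add: add.commute)
  qed simp
  have "P - [:poly P 0:] = 0"
  proof (rule ccontr)
    assume "P - [:poly P 0:] \<noteq> 0"
    then have "finite {x. poly (P - [:poly P 0:]) x = 0}"
      by (rule poly_roots_finite)
    moreover have "range real \<subseteq> {x. poly (P - [:poly P 0:]) x = 0}"
      using nat by auto
    ultimately have "finite (range real)"
      using finite_subset by blast
    then show False
      by (metis finite_imageD infinite_UNIV_nat inj_of_nat)
  qed
  then have "poly (P - [:poly P 0:]) x = 0" by simp
  then show ?thesis by simp
qed

lemma periodic_attains_max:
  fixes f :: "real \<Rightarrow> real"
  assumes cont: "continuous_on UNIV f" and per: "\<And>x. f (x + 1) = f x"
  obtains x0 where "\<And>x. f x \<le> f x0"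
proof -
  have nat: "f (x + real n) = f x" for x n
  proof (induction n)
    case (Suc n)
    then show ?case using per[of "x + real n"] by (simp add: algebra_simps)
  qed simp
  have int: "f (x + of_int k) = f x" for x k
  proof (cases k)
    case (nonneg n)
    then show ?thesis using nat by simp
  next
    case (neg n)
    then show ?thesis using nat[of "x + of_int k" "Suc n"] by simp
  qed
  obtain x0 where x0: "\<forall>x\<in>{0..1}. f x \<le> f x0"
    using continuous_attains_sup[of "{0..1}" f] continuous_on_subset[OF cont] by auto
  have "f x \<le> f x0" for x
  proof -
    have "f x = f (frac x)"
      using int[of "frac x" "\<lfloor>x\<rfloor>"] by (simp add: frac_def)
    moreover have "frac x \<in> {0..1}"
      by (simp add: frac_lt_1 less_imp_le)
    ultimately show ?thesis using x0 by simp
  qed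
  then show ?thesis using that by blast
qed

lemma poly_if_differences_poly:
  fixes f :: "real \<Rightarrow> real"
  assumes cont: "continuous_on UNIV f"
    and diff: "\<And>h. \<exists>P. \<forall>x. f (x + h) - f x = poly P x"
  shows "\<exists>P. \<forall>x. f x = poly P x"
proof -
  obtain P Q where P: "\<And>x. f (x + 1) - f x = poly P x"
    and Q: "\<And>x. poly Q (x + 1) - poly Q x = poly P x"
    using diff[of 1] poly_forward_difference_surj by metis
  \<comment> \<open>\<open>e\<close> is 1-periodic, so its differences are periodic polynomials, hence constant; comparing with a
    maximum point of \<open>e\<close> forces these constants to be zero.\<close>
  define e where "e x = f x - poly Q x" for x
  have per: "e (x + 1) = e x" for x
    using P[of x] Q[of x] by (simp add: e_def)
  have "continuous_on UNIV e"
    unfolding e_def by (intro continuous_intros cont)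
  then obtain x0 where x0: "\<And>x. e x \<le> e x0"
    using periodic_attains_max[of e] per by metis
  have "e h = e 0" for h
  proof -
    obtain R where R: "\<And>x. f (x + h) - f x = poly R x"
      using diff by blast
    define S where "S = R - (pcompose Q [:h, 1:] - Q)"
    have S: "e (x + h) - e x = poly S x" for x
      using R[of x] by (simp add: S_def e_def poly_pcompose algebra_simps)
    have "poly S (x + 1) = poly S x" for x
      using per[of "x + h"] per[of x] S[of x] S[of "x + 1"] by (simp add: algebra_simps)
    then have const: "e (x + h) - e x = poly S 0" for x
      unfolding S by (rule poly_periodic_const)
    from const[of x0] const[of "x0 - h"] const[of 0] x0[of "x0 + h"] x0[of "x0 - h"]
    show ?thesis by simp
  qed
  then have "f x - poly Q x = e 0" for x
    by (metis e_def)
  then have "f x = poly (Q + [:e 0:]) x" for x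
    by (simp add: diff_eq_eq add.commute)
  then show ?thesis by blast
qed

text \<open>This is Frechet's functional equation, with an independent step at each level. Its
  negation therefore supplies one step \<open>h\<close> whose difference still fails the equation of
  order one less, which is what the induction in \<open>approximable_powers\<close>
  consumes.\<close>

fun differences_vanish :: "nat \<Rightarrow> (real \<Rightarrow> real) \<Rightarrow> bool" where
  "differences_vanish 0 f \<longleftrightarrow> (\<forall>x. f x = 0)"
| "differences_vanish (Suc m) f \<longleftrightarrow> (\<forall>h. differences_vanish m (\<lambda>x. f (x + h) - f x))"

lemma continuous_on_difference:
  fixes f :: "real \<Rightarrow> real"
  assumes "continuous_on UNIV f"
  shows "continuous_on UNIV (\<lambda>x. f (x + h) - f x)"
proof -
  have "continuous_on UNIV (\<lambda>x. f (x + h))"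
    by (rule continuous_on_compose2[OF assms]) (auto intro!: continuous_intros)
  with assms show ?thesis by (rule continuous_on_diff[rotated])
qed

lemma differences_vanish_imp_poly:
  assumes "continuous_on UNIV f" "differences_vanish m f"
  shows "\<exists>P. \<forall>x. f x = poly P x"
  using assms
proof (induction m arbitrary: f)
  case 0
  then show ?case by (intro exI[of _ 0]) simp
next
  case (Suc m)
  show ?case
  proof (rule poly_if_differences_poly[OF Suc.prems(1)])
    show "\<exists>P. \<forall>x. f (x + h) - f x = poly P x" for h
      using Suc.prems(2) by (intro Suc.IH continuous_on_difference[OF Suc.prems(1)]) simp
  qed
qed

lemma continuous_has_antiderivative:
  fixes f :: "real \<Rightarrow> real"
  assumes "continuous_on UNIV f"
  obtains F where "\<And>x. (F has_real_derivative f x) (at x)"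
proof -
  have "isCont f x" for x
    using assms by (simp add: continuous_on_eq_continuous_at)
  then show ?thesis
    using einterval_antiderivative[of "-\<infinity>" \<infinity> f] that
    by (auto simp: has_real_derivative_iff_has_vector_derivative)
qed

section \<open>Linear spans and their uniform closure\<close>

text \<open>The linear span of \<open>G\<close>, in inductive form so that closure under products
  can be shown by rule induction.\<close>

inductive_set fun_span :: "('a \<Rightarrow> real) set \<Rightarrow> ('a \<Rightarrow> real) set" for G where
  zero: "(\<lambda>x. 0) \<in> fun_span G"
| base: "g \<in> G \<Longrightarrow> g \<in> fun_span G"
| add: "f \<in> fun_span G \<Longrightarrow> g \<in> fun_span G \<Longrightarrow> (\<lambda>x. f x + g x) \<in> fun_span G"
| scale: "f \<in> fun_span G \<Longrightarrow> (\<lambda>x. c * f x) \<in> fun_span G"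

text \<open>Making \<open>c\<close> vanish off \<open>F\<close> allows an expansion to be rewritten
  over any larger finite index set; the sum case and the common support of several functions both
  rely on this.\<close>

lemma fun_span_finite:
  assumes "f \<in> fun_span G"
  shows "\<exists>F c. finite F \<and> F \<subseteq> G \<and> (\<forall>g. g \<notin> F \<longrightarrow> c g = 0) \<and> (\<forall>x. f x = (\<Sum>g\<in>F. c g * g x))"
  using assms
proof induction
  case zero
  show ?case by (rule exI[of _ "{}"]) auto
next
  case (base g)
  then show ?case
    by (intro exI[of _ "{g}"] exI[of _ "\<lambda>h. if h = g then 1 else 0"]) auto
next
  case (add f1 f2)
  obtain F1 c1 where F1: "finite F1" "F1 \<subseteq> G" "\<forall>g. g \<notin> F1 \<longrightarrow> c1 g = 0"
    and f1: "\<forall>x. f1 x = (\<Sum>g\<in>F1. c1 g * g x)"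
    using add.IH(1) by blast
  obtain F2 c2 where F2: "finite F2" "F2 \<subseteq> G" "\<forall>g. g \<notin> F2 \<longrightarrow> c2 g = 0"
    and f2: "\<forall>x. f2 x = (\<Sum>g\<in>F2. c2 g * g x)"
    using add.IH(2) by blast
  have "f1 x = (\<Sum>g\<in>F1 \<union> F2. c1 g * g x)" for x
    unfolding f1[rule_format] using F1 F2 by (intro sum.mono_neutral_left) auto
  moreover have "f2 x = (\<Sum>g\<in>F1 \<union> F2. c2 g * g x)" for x
    unfolding f2[rule_format] using F1 F2 by (intro sum.mono_neutral_left) auto
  ultimately have "\<forall>x. f1 x + f2 x = (\<Sum>g\<in>F1 \<union> F2. (c1 g + c2 g) * g x)"
    by (simp add: sum.distrib distrib_right)
  then show ?case
    using F1 F2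
    by (intro exI[of _ "F1 \<union> F2"] exI[of _ "\<lambda>g. c1 g + c2 g"]) auto
next
  case (scale f d)
  then obtain F c where "finite F" "F \<subseteq> G" "\<forall>g. g \<notin> F \<longrightarrow> c g = 0"
    "\<forall>x. f x = (\<Sum>g\<in>F. c g * g x)"
    by blast
  then show ?case
    by (intro exI[of _ F] exI[of _ "\<lambda>g. d * c g"]) (auto simp: sum_distrib_left mult.assoc)
qed

text \<open>The uniform closure of the span on \<open>K\<close>. Members are functions on the whole
  type, with values outside \<open>K\<close> left unconstrained.\<close>

definition approximable :: "('a \<Rightarrow> real) set \<Rightarrow> 'a set \<Rightarrow> ('a \<Rightarrow> real) set" where
  "approximable G K = {f. \<forall>e>0. \<exists>s\<in>fun_span G. \<forall>x\<in>K. \<bar>f x - s x\<bar> < e}"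

lemma approximableE:
  assumes "f \<in> approximable G K" "e > 0"
  obtains s where "s \<in> fun_span G" "\<And>x. x \<in> K \<Longrightarrow> \<bar>f x - s x\<bar> < e"
  using assms by (auto simp: approximable_def)

lemma fun_span_approximable: "f \<in> fun_span G \<Longrightarrow> f \<in> approximable G K"
  unfolding approximable_def by (intro CollectI allI impI bexI[of _ f]) auto

lemma approximable_add:
  assumes "f \<in> approximable G K" "g \<in> approximable G K"
  shows "(\<lambda>x. f x + g x) \<in> approximable G K"
  unfolding approximable_def
proof (intro CollectI allI impI)
  fix e :: real assume "e > 0"
  then have "e/2 > 0" by simp
  obtain s where s: "s \<in> fun_span G" "\<And>x. x \<in> K \<Longrightarrow> \<bar>f x - s x\<bar> < e/2"
    using approximableE[OF assms(1) \<open>e/2 > 0\<close>] by blast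
  obtain t where t: "t \<in> fun_span G" "\<And>x. x \<in> K \<Longrightarrow> \<bar>g x - t x\<bar> < e/2"
    using approximableE[OF assms(2) \<open>e/2 > 0\<close>] by blast
  have "\<bar>f x + g x - (s x + t x)\<bar> < e" if "x \<in> K" for x
    using s(2)[OF that] t(2)[OF that] by linarith
  then show "\<exists>s\<in>fun_span G. \<forall>x\<in>K. \<bar>f x + g x - s x\<bar> < e"
    using fun_span.add[OF s(1) t(1)] by (intro bexI[where x = "\<lambda>x. s x + t x"]) auto
qed

lemma approximable_scale:
  assumes "f \<in> approximable G K"
  shows "(\<lambda>x. c * f x) \<in> approximable G K"
  unfolding approximable_def
proof (intro CollectI allI impI)
  fix e :: real assume "e > 0"
  \<comment> \<open>The added 1 covers \<open>c = 0\<close>.\<close>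
  then have "e / (\<bar>c\<bar> + 1) > 0" by simp
  then obtain s where s: "s \<in> fun_span G" "\<And>x. x \<in> K \<Longrightarrow> \<bar>f x - s x\<bar> < e / (\<bar>c\<bar> + 1)"
    using approximableE[OF assms] by blast
  have "\<bar>c * f x - c * s x\<bar> < e" if "x \<in> K" for x
  proof -
    have "\<bar>c * f x - c * s x\<bar> = \<bar>c\<bar> * \<bar>f x - s x\<bar>"
      by (metis abs_mult right_diff_distrib)
    also have "\<dots> \<le> (\<bar>c\<bar> + 1) * \<bar>f x - s x\<bar>"
      by (intro mult_right_mono) auto
    also have "\<dots> < e"
      using s(2)[OF that] by (simp add: pos_less_divide_eq mult.commute)
    finally show ?thesis .
  qed
  then show "\<exists>s\<in>fun_span G. \<forall>x\<in>K. \<bar>c * f x - s x\<bar> < e"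
    using fun_span.scale[OF s(1), of c] by (intro bexI[where x = "\<lambda>x. c * s x"]) auto
qed

lemma approximable_diff:
  assumes "f \<in> approximable G K" "g \<in> approximable G K"
  shows "(\<lambda>x. f x - g x) \<in> approximable G K"
  using approximable_add[OF assms(1) approximable_scale[OF assms(2), of "-1"]] by simp

lemma approximable_sum:
  assumes "finite I" "\<And>i. i \<in> I \<Longrightarrow> f i \<in> approximable G K"
  shows "(\<lambda>x. \<Sum>i\<in>I. f i x) \<in> approximable G K"
  using assms
  by (induction I) (auto intro: approximable_add fun_span_approximable fun_span.zero)

lemma approximable_limit:
  assumes "\<And>e. e > 0 \<Longrightarrow> \<exists>s\<in>approximable G K. \<forall>x\<in>K. \<bar>f x - s x\<bar> < e"
  shows "f \<in> approximable G K"
  unfolding approximable_def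
proof (intro CollectI allI impI)
  fix e :: real assume "e > 0"
  then have "e/2 > 0" by simp
  from assms[OF this] obtain s where s: "s \<in> approximable G K" "\<And>x. x \<in> K \<Longrightarrow> \<bar>f x - s x\<bar> < e/2"
    by blast
  obtain t where t: "t \<in> fun_span G" "\<And>x. x \<in> K \<Longrightarrow> \<bar>s x - t x\<bar> < e/2"
    using approximableE[OF s(1) \<open>e/2 > 0\<close>] by blast
  have "\<bar>f x - t x\<bar> < e" if "x \<in> K" for x
    using s(2)[OF that] t(2)[OF that] by linarith
  then show "\<exists>s\<in>fun_span G. \<forall>x\<in>K. \<bar>f x - s x\<bar> < e"
    using t(1) by blast
qed

text \<open>This lets the exponentials act as intermediate generators between continuous functions
  and ridge functions.\<close>

lemma approximable_trans:
  assumes "f \<in> approximable G K" "G \<subseteq> approximable H K"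
  shows "f \<in> approximable H K"
proof (rule approximable_limit)
  have span: "s \<in> approximable H K" if "s \<in> fun_span G" for s
    using that assms(2)
    by induction (auto intro: fun_span_approximable fun_span.zero approximable_add approximable_scale)
  fix e :: real assume "e > 0"
  then obtain s where s: "s \<in> fun_span G" "\<And>x. x \<in> K \<Longrightarrow> \<bar>f x - s x\<bar> < e"
    using approximableE[OF assms(1)] by blast
  show "\<exists>s\<in>approximable H K. \<forall>x\<in>K. \<bar>f x - s x\<bar> < e"
    using span[OF s(1)] s(2) by (intro bexI[of _ s]) auto
qed

section \<open>Uniform estimates from one-variable calculus\<close>

lemma compact_abs_bound:
  fixes f :: "'a::topological_space \<Rightarrow> real"
  assumes "compact K" "continuous_on K f"
  obtains B where "B > 0" "\<And>x. x \<in> K \<Longrightarrow> \<bar>f x\<bar> \<le> B"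
proof -
  have "bounded (f ` K)"
    using assms by (intro compact_imp_bounded compact_continuous_image)
  then show ?thesis
    using that by (auto simp: bounded_pos)
qed

lemma uniform_modulus:
  fixes f :: "real \<Rightarrow> real"
  assumes "continuous_on UNIV f" "e > 0"
  obtains d where "d > 0" "\<And>s t. \<bar>s\<bar> \<le> C \<Longrightarrow> \<bar>t\<bar> \<le> C \<Longrightarrow> \<bar>s - t\<bar> < d \<Longrightarrow> \<bar>f s - f t\<bar> < e"
proof -
  have "uniformly_continuous_on {-C..C} f"
    using assms(1) by (intro compact_uniformly_continuous) (auto intro: continuous_on_subset)
  from uniformly_continuous_onE[OF this assms(2)] obtain d where
    "d > 0" "\<And>s t. s \<in> {-C..C} \<Longrightarrow> t \<in> {-C..C} \<Longrightarrow> dist t s < d \<Longrightarrow> dist (f t) (f s) < e"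
    by metis
  then show ?thesis
    by (intro that[of d]) (auto simp: dist_real_def abs_le_iff)
qed

text \<open>Covering increments of either sign and zero spares later arguments a case split, as
  \<open>t * (v \<bullet> y)\<close> changes sign with \<open>y\<close>.\<close>

lemma mean_value:
  fixes F f :: "real \<Rightarrow> real"
  assumes "\<And>x. (F has_real_derivative f x) (at x)"
  obtains z where "\<bar>z - x\<bar> \<le> \<bar>h\<bar>" "F (x + h) - F x = h * f z"
proof (cases h "0 :: real" rule: linorder_cases)
  case less
  then obtain z where "x + h < z" "z < x" "F x - F (x + h) = (x - (x + h)) * f z"
    using MVT2[of "x + h" x F f] assms by auto
  then show ?thesis
    by (intro that[of z]) (auto simp: algebra_simps)
next
  case equal
  then show ?thesis by (intro that[of x]) auto
next
  case greater
  then obtain z where "x < z" "z < x + h" "F (x + h) - F x = (x + h - x) * f z"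
    using MVT2[of x "x + h" F f] assms by auto
  then show ?thesis
    by (intro that[of z]) auto
qed

lemma riemann_sum_uniform:
  fixes F f :: "real \<Rightarrow> real"
  assumes deriv: "\<And>x. (F has_real_derivative f x) (at x)"
    and cont: "continuous_on UNIV f" and "e > 0"
  obtains n d where "\<And>x. \<bar>x\<bar> \<le> C \<Longrightarrow> \<bar>F (x + h) - F x - (\<Sum>k<n. d * f (x + real k * d))\<bar> < e"
proof -
  \<comment> \<open>The \<open>n\<close> pieces of length \<open>\<bar>d\<bar>\<close> contribute at
    most \<open>\<bar>d\<bar> * \<eta>\<close> each, in total
    \<open>\<bar>h\<bar> * \<eta> < e\<close>; the added 1 covers \<open>h = 0\<close>.\<close>
  define \<eta> where "\<eta> = e / (\<bar>h\<bar> + 1)"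
  have "\<eta> > 0" using \<open>e > 0\<close> by (simp add: \<eta>_def)
  \<comment> \<open>Sample points stay within \<open>C + \<bar>h\<bar>\<close>, and mean-value
    points lie at most \<open>\<bar>d\<bar> \<le> \<bar>h\<bar>\<close> further away.\<close>
  obtain \<delta> where "\<delta> > 0" and \<delta>: "\<And>s t. \<bar>s\<bar> \<le> C + 2 * \<bar>h\<bar> \<Longrightarrow> \<bar>t\<bar> \<le> C + 2 * \<bar>h\<bar> \<Longrightarrow> \<bar>s - t\<bar> < \<delta> \<Longrightarrow> \<bar>f s - f t\<bar> < \<eta>"
    using uniform_modulus[OF cont \<open>\<eta> > 0\<close>] by metis
  obtain n :: nat where n: "\<bar>h\<bar> / \<delta> < real n"
    using reals_Archimedean2 by blast
  have "n > 0" using n \<open>\<delta> > 0\<close>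
    by (metis abs_ge_zero divide_nonneg_pos gr_zeroI of_nat_0 not_le)
  define d where "d = h / real n"
  have d: "\<bar>d\<bar> < \<delta>" "\<bar>h\<bar> = real n * \<bar>d\<bar>" "h = real n * d"
    using n \<open>n > 0\<close> \<open>\<delta> > 0\<close> by (auto simp: d_def field_simps)
  have "\<bar>F (x + h) - F x - (\<Sum>k<n. d * f (x + real k * d))\<bar> < e" if x: "\<bar>x\<bar> \<le> C" for x
  proof -
    have step: "\<bar>F (x + real (Suc k) * d) - F (x + real k * d) - d * f (x + real k * d)\<bar> \<le> \<bar>d\<bar> * \<eta>"
      if "k < n" for k
    proof -
      obtain z where z: "\<bar>z - (x + real k * d)\<bar> \<le> \<bar>d\<bar>"
        "F ((x + real k * d) + d) - F (x + real k * d) = d * f z"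
        using mean_value[OF deriv] by metis
      have "real k * \<bar>d\<bar> \<le> \<bar>h\<bar>" "\<bar>d\<bar> \<le> \<bar>h\<bar>"
        using that \<open>n > 0\<close> unfolding d(2) by (auto intro: mult_right_mono simp: mult_le_cancel_right1)
      moreover have "\<bar>real k * d\<bar> = real k * \<bar>d\<bar>"
        by (simp add: abs_mult)
      ultimately have "\<bar>z\<bar> \<le> C + 2 * \<bar>h\<bar>" "\<bar>x + real k * d\<bar> \<le> C + 2 * \<bar>h\<bar>"
        using z(1) x by linarith+
      then have "\<bar>f z - f (x + real k * d)\<bar> < \<eta>"
        using z(1) d(1) by (intro \<delta>) auto
      then have "\<bar>d\<bar> * \<bar>f z - f (x + real k * d)\<bar> \<le> \<bar>d\<bar> * \<eta>"
        by (intro mult_left_mono) auto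
      moreover have "F (x + real (Suc k) * d) - F (x + real k * d) - d * f (x + real k * d)
          = d * (f z - f (x + real k * d))"
        using z(2) by (simp add: algebra_simps)
      ultimately show ?thesis by (simp add: abs_mult)
    qed
    have "F (x + h) - F x = (\<Sum>k<n. F (x + real (Suc k) * d) - F (x + real k * d))"
      using sum_lessThan_telescope[of "\<lambda>k. F (x + real k * d)" n] d(3) by simp
    then have "\<bar>F (x + h) - F x - (\<Sum>k<n. d * f (x + real k * d))\<bar>
        = \<bar>\<Sum>k<n. F (x + real (Suc k) * d) - F (x + real k * d) - d * f (x + real k * d)\<bar>"
      by (simp only: sum_subtractf)
    also have "\<dots> \<le> (\<Sum>k<n. \<bar>F (x + real (Suc k) * d) - F (x + real k * d) - d * f (x + real k * d)\<bar>)"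
      by (rule sum_abs)
    also have "\<dots> \<le> (\<Sum>k<n. \<bar>d\<bar> * \<eta>)"
      by (intro sum_mono step) auto
    also have "\<dots> = \<bar>h\<bar> * \<eta>"
      using d(2) by simp
    also have "\<dots> < e"
      using \<open>e > 0\<close> by (simp add: \<eta>_def field_simps)
    finally show ?thesis .
  qed
  then show ?thesis using that by blast
qed

section \<open>Powers of linear forms in the closure\<close>

text \<open>The increment of \<open>F\<close> is the integral of \<open>f\<close> over a step of
  length \<open>h\<close>. Its Riemann sums converge uniformly in \<open>y\<close>, and each sample
  point only shifts \<open>b\<close>, so every summand is covered by the hypothesis.\<close>

lemma approximable_average:
  fixes \<phi> L :: "'a::topological_space \<Rightarrow> real"
  assumes K: "compact K" and \<phi>: "continuous_on K \<phi>" and L: "continuous_on K L"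
    and deriv: "\<And>x. (F has_real_derivative f x) (at x)"
    and cont: "continuous_on UNIV f"
    and appr: "\<And>b. (\<lambda>y. \<phi> y * f (L y + b)) \<in> approximable G K"
  shows "(\<lambda>y. \<phi> y * (F (L y + b + h) - F (L y + b))) \<in> approximable G K"
proof (rule approximable_limit)
  fix e :: real assume "e > 0"
  obtain B where B: "B > 0" "\<And>y. y \<in> K \<Longrightarrow> \<bar>\<phi> y\<bar> \<le> B"
    using compact_abs_bound[OF K \<phi>] by blast
  obtain C where C: "\<And>y. y \<in> K \<Longrightarrow> \<bar>L y + b\<bar> \<le> C"
    using compact_abs_bound[OF K continuous_on_add[OF L continuous_on_const]] by blast
  have "e / B > 0" using B(1) \<open>e > 0\<close> by simp
  then obtain n d where nd: "\<And>x. \<bar>x\<bar> \<le> C \<Longrightarrow> \<bar>F (x + h) - F x - (\<Sum>k<n. d * f (x + real k * d))\<bar> < e / B"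
    using riemann_sum_uniform[OF deriv cont] by metis
  define s where "s y = (\<Sum>k<n. d * (\<phi> y * f (L y + (b + real k * d))))" for y
  have s_eq: "s y = \<phi> y * (\<Sum>k<n. d * f (L y + b + real k * d))" for y
    unfolding s_def sum_distrib_left by (intro sum.cong) (auto simp: algebra_simps)
  have "s \<in> approximable G K"
    unfolding s_def by (intro approximable_sum approximable_scale appr) auto
  moreover have "\<bar>\<phi> y * (F (L y + b + h) - F (L y + b)) - s y\<bar> < e" if "y \<in> K" for y
  proof -
    have "\<bar>\<phi> y * (F (L y + b + h) - F (L y + b)) - s y\<bar>
        = \<bar>\<phi> y\<bar> * \<bar>F (L y + b + h) - F (L y + b) - (\<Sum>k<n. d * f (L y + b + real k * d))\<bar>"
      unfolding s_eq by (simp only: abs_mult[symmetric] right_diff_distrib)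
    also have "\<dots> \<le> B * \<bar>F (L y + b + h) - F (L y + b) - (\<Sum>k<n. d * f (L y + b + real k * d))\<bar>"
      by (intro mult_right_mono B(2) that) auto
    also have "\<dots> < e"
      using nd[OF C[OF that]] B(1) by (simp add: pos_less_divide_eq mult.commute)
    finally show ?thesis .
  qed
  ultimately show "\<exists>s\<in>approximable G K. \<forall>y\<in>K. \<bar>\<phi> y * (F (L y + b + h) - F (L y + b)) - s y\<bar> < e"
    by blast
qed

text \<open>Differentiating \<open>g (w \<bullet> y + b)\<close> in the weight \<open>w\<close>
  along \<open>v\<close> produces the factor \<open>v \<bullet> y\<close>. The difference quotients
  converge uniformly on \<open>K\<close> by the mean value theorem and uniform continuity of
  \<open>g'\<close>.\<close>

lemma approximable_directional_derivative:
  fixes \<phi> :: "'a::euclidean_space \<Rightarrow> real"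
  assumes K: "compact K" and \<phi>: "continuous_on K \<phi>"
    and deriv: "\<And>x. (g has_real_derivative g' x) (at x)"
    and cont: "continuous_on UNIV g'"
    and appr: "\<And>w. (\<lambda>y. \<phi> y * g (w \<bullet> y + b)) \<in> approximable G K"
  shows "(\<lambda>y. (v \<bullet> y) * \<phi> y * g' (w \<bullet> y + b)) \<in> approximable G K"
proof (rule approximable_limit)
  fix e :: real assume "e > 0"
  obtain B where B: "B > 0" "\<And>y. y \<in> K \<Longrightarrow> \<bar>(v \<bullet> y) * \<phi> y\<bar> \<le> B"
    using compact_abs_bound[OF K continuous_on_mult[OF continuous_on_inner[OF continuous_on_const continuous_on_id] \<phi>]]
    by blast
  obtain C where C: "\<And>y. y \<in> K \<Longrightarrow> \<bar>w \<bullet> y + b\<bar> \<le> C"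
    using compact_abs_bound[OF K continuous_on_add[OF continuous_on_inner[OF continuous_on_const continuous_on_id] continuous_on_const]]
    by blast
  obtain D where D: "D > 0" "\<And>y. y \<in> K \<Longrightarrow> \<bar>v \<bullet> y\<bar> \<le> D"
    using compact_abs_bound[OF K continuous_on_inner[OF continuous_on_const continuous_on_id]] by blast
  have "e / B > 0" using B(1) \<open>e > 0\<close> by simp
  obtain \<delta> where "\<delta> > 0" and \<delta>: "\<And>s t. \<bar>s\<bar> \<le> C + D \<Longrightarrow> \<bar>t\<bar> \<le> C + D \<Longrightarrow> \<bar>s - t\<bar> < \<delta> \<Longrightarrow> \<bar>g' s - g' t\<bar> < e / B"
    using uniform_modulus[OF cont \<open>e / B > 0\<close>] by metis
  \<comment> \<open>The bound \<open>t \<le> 1\<close> keeps the mean-value point within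
    \<open>C + D\<close>; \<open>t * D < \<delta>\<close> makes the two values of \<open>g'\<close>
    close, the factor 2 giving strictness.\<close>
  define t where "t = min 1 (\<delta> / (2 * D))"
  have t: "0 < t" "t \<le> 1" "t * D < \<delta>"
    using \<open>\<delta> > 0\<close> D(1) by (auto simp: t_def min_def field_simps)
  define s where "s y = 1 / t * (\<phi> y * g ((w + t *\<^sub>R v) \<bullet> y + b) - \<phi> y * g (w \<bullet> y + b))" for y
  have "s \<in> approximable G K"
    unfolding s_def by (intro approximable_scale approximable_diff appr)
  moreover have "\<bar>(v \<bullet> y) * \<phi> y * g' (w \<bullet> y + b) - s y\<bar> < e" if "y \<in> K" for y
  proof -
    obtain z where z: "\<bar>z - (w \<bullet> y + b)\<bar> \<le> \<bar>t * (v \<bullet> y)\<bar>"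
      "g ((w \<bullet> y + b) + t * (v \<bullet> y)) - g (w \<bullet> y + b) = t * (v \<bullet> y) * g' z"
      using mean_value[OF deriv] by metis
    have "(w + t *\<^sub>R v) \<bullet> y + b = (w \<bullet> y + b) + t * (v \<bullet> y)"
      by (simp add: inner_add_left)
    then have "s y = 1 / t * (\<phi> y * (g ((w \<bullet> y + b) + t * (v \<bullet> y)) - g (w \<bullet> y + b)))"
      by (simp only: s_def right_diff_distrib)
    also have "\<dots> = (v \<bullet> y) * \<phi> y * g' z"
      unfolding z(2) using t(1) by simp
    finally have s_eq: "s y = (v \<bullet> y) * \<phi> y * g' z" .
    have "\<bar>t * (v \<bullet> y)\<bar> \<le> t * D"
      using t(1) D(2)[OF that] by (simp add: abs_mult)
    moreover have "t * D \<le> D"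
      using t D(1) by (simp add: mult_left_le_one_le)
    ultimately have "\<bar>g' (w \<bullet> y + b) - g' z\<bar> < e / B"
      using z(1) t C[OF that] D(1) by (intro \<delta>) linarith+
    have "\<bar>(v \<bullet> y) * \<phi> y * g' (w \<bullet> y + b) - s y\<bar> = \<bar>(v \<bullet> y) * \<phi> y\<bar> * \<bar>g' (w \<bullet> y + b) - g' z\<bar>"
      unfolding s_eq by (simp only: abs_mult[symmetric] right_diff_distrib)
    also have "\<dots> \<le> B * \<bar>g' (w \<bullet> y + b) - g' z\<bar>"
      by (intro mult_right_mono B(2) that) auto
    also have "\<dots> < e"
      using \<open>\<bar>g' (w \<bullet> y + b) - g' z\<bar> < e / B\<close> B(1) by (simp add: pos_less_divide_eq mult.commute)
    finally show ?thesis .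
  qed
  ultimately show "\<exists>s\<in>approximable G K. \<forall>y\<in>K. \<bar>(v \<bullet> y) * \<phi> y * g' (w \<bullet> y + b) - s y\<bar> < e"
    by blast
qed

lemma approximable_powers:
  fixes v :: "'a::euclidean_space"
  assumes "compact K" "continuous_on UNIV f" "\<not> differences_vanish m f"
    and "\<And>w b. (\<lambda>y. (v \<bullet> y) ^ k * f (w \<bullet> y + b)) \<in> approximable G K"
  shows "(\<lambda>y. (v \<bullet> y) ^ (k + m)) \<in> approximable G K"
  using assms(2-)
proof (induction m arbitrary: f k)
  case 0
  \<comment> \<open>With \<open>w = 0\<close> and \<open>b = x\<close> the factor containing
    \<open>f\<close> is the nonzero constant \<open>f x\<close>, which can be divided out.\<close>
  then obtain x where "f x \<noteq> 0" by auto
  then show ?case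
    using approximable_scale[OF "0.prems"(3)[of 0 x], of "1 / f x"] by simp
next
  case (Suc m)
  from Suc.prems(2) obtain h where h: "\<not> differences_vanish m (\<lambda>x. f (x + h) - f x)"
    by auto
  obtain F where F: "\<And>x. (F has_real_derivative f x) (at x)"
    using continuous_has_antiderivative[OF Suc.prems(1)] by blast
  have cont: "continuous_on UNIV (\<lambda>x. f (x + h) - f x)"
    by (rule continuous_on_difference[OF Suc.prems(1)])
  have avg: "(\<lambda>y. (v \<bullet> y) ^ k * (F (w \<bullet> y + b + h) - F (w \<bullet> y + b))) \<in> approximable G K" for w b
    by (rule approximable_average[OF assms(1) _ _ F Suc.prems(1) Suc.prems(3)])
      (auto intro!: continuous_intros)
  \<comment> \<open>The averaged function is continuously differentiable although \<open>f\<close>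
    is only continuous; its derivative is the difference of \<open>f\<close> on which the induction
    continues, with exponent \<open>Suc k\<close>.\<close>
  have deriv: "((\<lambda>x. F (x + h) - F x) has_real_derivative f (x + h) - f x) (at x)" for x
    by (intro DERIV_diff F) (simp add: DERIV_shift[symmetric] F)
  have "(\<lambda>y. (v \<bullet> y) * (v \<bullet> y) ^ k * (f (w \<bullet> y + b + h) - f (w \<bullet> y + b))) \<in> approximable G K" for w b
    by (rule approximable_directional_derivative[OF assms(1) _ deriv cont])
      (auto intro!: continuous_intros avg)
  then have "(\<lambda>y. (v \<bullet> y) ^ (Suc k + m)) \<in> approximable G K"
    by (intro Suc.IH[OF cont h]) simp
  then show ?case by simp
qed

section \<open>Exponentials and the Stone--Weierstrass theorem\<close>

text \<open>Taylor polynomials of \<open>exp\<close> converge uniformly on \<open>K\<close>: where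
  \<open>\<bar>L y\<bar> \<le> B\<close>, the Lagrange remainder is at most
  \<open>exp B * B ^ n / fact n\<close>, which tends to 0.\<close>

lemma approximable_exp:
  fixes L :: "'a::topological_space \<Rightarrow> real"
  assumes "compact K" "continuous_on K L"
    and powers: "\<And>m. (\<lambda>y. L y ^ m) \<in> approximable G K"
  shows "(\<lambda>y. exp (L y)) \<in> approximable G K"
proof (rule approximable_limit)
  fix e :: real assume "e > 0"
  obtain B where B: "B > 0" "\<And>y. y \<in> K \<Longrightarrow> \<bar>L y\<bar> \<le> B"
    using compact_abs_bound[OF assms(1,2)] by blast
  have "(\<lambda>n. exp B * (inverse (fact n) * B ^ n)) \<longlonglongrightarrow> exp B * 0"
    by (intro tendsto_mult_left summable_LIMSEQ_zero summable_exp)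
  then have "eventually (\<lambda>n. exp B * (inverse (fact n) * B ^ n) < e) sequentially"
    using \<open>e > 0\<close> by (intro order_tendstoD(2)) auto
  then obtain n where n: "exp B * (inverse (fact n) * B ^ n) < e"
    using eventually_happens' sequentially_bot by blast
  define s where "s y = (\<Sum>m<n. 1 / fact m * L y ^ m)" for y
  have "s \<in> approximable G K"
    unfolding s_def by (intro approximable_sum approximable_scale powers) auto
  moreover have "\<bar>exp (L y) - s y\<bar> < e" if "y \<in> K" for y
  proof -
    obtain t where t: "\<bar>t\<bar> \<le> \<bar>L y\<bar>" "exp (L y) = (\<Sum>m<n. L y ^ m / fact m) + exp t / fact n * L y ^ n"
      using Maclaurin_exp_le by blast
    then have "\<bar>exp (L y) - s y\<bar> = exp t * (inverse (fact n) * \<bar>L y\<bar> ^ n)"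
      by (simp add: s_def abs_mult power_abs divide_inverse mult.commute)
    also have "\<dots> \<le> exp B * (inverse (fact n) * B ^ n)"
      using t(1) B(2)[OF that] by (intro mult_mono power_mono) auto
    finally show ?thesis using n by simp
  qed
  ultimately show "\<exists>s\<in>approximable G K. \<forall>y\<in>K. \<bar>exp (L y) - s y\<bar> < e"
    by blast
qed

lemma exponentials_dense:
  fixes \<phi> :: "'a::euclidean_space \<Rightarrow> real"
  assumes "compact K" "continuous_on K \<phi>"
  shows "\<phi> \<in> approximable (range (\<lambda>v y. exp (v \<bullet> y))) K"
proof -
  define E :: "('a \<Rightarrow> real) set" where "E = range (\<lambda>v y. exp (v \<bullet> y))"
  have E: "(\<lambda>y. exp (v \<bullet> y)) \<in> fun_span E" for v
    unfolding E_def by (intro fun_span.base) blast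
  \<comment> \<open>Closure under products takes two inductions: first against a single exponential,
    using \<open>exp (w \<bullet> y) * exp (v \<bullet> y) = exp ((w + v) \<bullet> y)\<close>, then
    against the whole span.\<close>
  have mult_base: "(\<lambda>y. f y * exp (v \<bullet> y)) \<in> fun_span E" if "f \<in> fun_span E" for f v
    using that
  proof induction
    case zero
    show ?case using fun_span.zero by simp
  next
    case (base g)
    then obtain w where "g = (\<lambda>y. exp (w \<bullet> y))" by (auto simp: E_def)
    then show ?case using E[of "w + v"] by (simp add: inner_add_left exp_add)
  next
    case (add f g)
    then show ?case using fun_span.add[OF add.IH] by (simp add: distrib_right)
  next
    case (scale f c)
    then show ?case using fun_span.scale[OF scale.IH, of c] by (simp add: mult.assoc)
  qed
  have mult: "(\<lambda>y. f y * g y) \<in> fun_span E" if "f \<in> fun_span E" "g \<in> fun_span E" for f g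
    using that(2)
  proof induction
    case zero
    show ?case using fun_span.zero by simp
  next
    case (base g)
    then show ?case using mult_base[OF that(1)] by (auto simp: E_def)
  next
    case (add g h)
    then show ?case using fun_span.add[OF add.IH] by (simp add: distrib_left)
  next
    case (scale g c)
    then show ?case using fun_span.scale[OF scale.IH, of c] by (simp add: mult.left_commute)
  qed
  have cont: "continuous_on K f" if "f \<in> fun_span E" for f
    using that by induction (auto simp: E_def intro!: continuous_intros)
  interpret function_ring_on "fun_span E" K
  proof
    show "(\<lambda>_. c) \<in> fun_span E" for c
      using fun_span.scale[OF E[of 0], of c] by simp
    show "\<exists>f\<in>fun_span E. f x \<noteq> f y" if "x \<noteq> y" for x y
    \<comment> \<open>The direction \<open>x - y\<close> separates the points, since its inner
      products with \<open>x\<close> and \<open>y\<close> differ by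
      \<open>(x - y) \<bullet> (x - y)\<close>.\<close>
    proof (rule bexI[OF _ E[of "x - y"]])
      have "(x - y) \<bullet> x - (x - y) \<bullet> y \<noteq> 0"
        using that by (simp add: inner_diff_right[symmetric])
      then show "exp ((x - y) \<bullet> x) \<noteq> exp ((x - y) \<bullet> y)" by simp
    qed
  qed (auto intro: assms(1) cont mult fun_span.add)
  show ?thesis
    using Stone_Weierstrass_basic[OF assms(2)] unfolding approximable_def E_def[symmetric] by blast
qed

lemma ridge_functions_dense:
  fixes \<sigma> :: "real \<Rightarrow> real" and \<phi> :: "'a::euclidean_space \<Rightarrow> real"
  assumes \<sigma>: "continuous_on UNIV \<sigma>" "\<not> (\<exists>P. \<forall>x. \<sigma> x = poly P x)"
    and K: "compact K" and \<phi>: "continuous_on K \<phi>"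
  shows "\<phi> \<in> approximable (range (\<lambda>(w, b) y. \<sigma> (w \<bullet> y + b))) K"
proof (rule approximable_trans[OF exponentials_dense[OF K \<phi>]])
  let ?G = "range (\<lambda>(w :: 'a, b) y. \<sigma> (w \<bullet> y + b))"
  have G: "(\<lambda>y. \<sigma> (w \<bullet> y + b)) \<in> approximable ?G K" for w b
    by (intro fun_span_approximable fun_span.base) force
  \<comment> \<open>With starting exponent \<open>k = 0\<close> the hypothesis on products concerns
    only the ridge functions themselves.\<close>
  have "(\<lambda>y. (v \<bullet> y) ^ (0 + m)) \<in> approximable ?G K" for v m
  proof (rule approximable_powers[OF K \<sigma>(1)])
    show "\<not> differences_vanish m \<sigma>"
      using \<sigma>(2) differences_vanish_imp_poly[OF \<sigma>(1)] by blast
  qed (use G in simp)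
  then show "range (\<lambda>v y. exp (v \<bullet> y)) \<subseteq> approximable ?G K"
    by (auto intro!: approximable_exp K continuous_intros)
qed

section \<open>Simultaneous approximation with boundary values\<close>

text \<open>This makes the weights and biases independent of \<open>n\<close>: take the union of the
  supports and extend each coefficient family by zero.\<close>

lemma fun_span_common_finite:
  assumes "finite I" "\<And>n. n \<in> I \<Longrightarrow> s n \<in> fun_span G"
  obtains F c where "finite F" "F \<subseteq> G" "\<And>n x. n \<in> I \<Longrightarrow> s n x = (\<Sum>g\<in>F. c n g * g x)"
proof -
  have "\<forall>n\<in>I. \<exists>F c. finite F \<and> F \<subseteq> G \<and> (\<forall>g. g \<notin> F \<longrightarrow> c g = 0) \<and> (\<forall>x. s n x = (\<Sum>g\<in>F. c g * g x))"
    using fun_span_finite[OF assms(2)] by blast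
  then obtain F c where Fc: "\<forall>n\<in>I. finite (F n) \<and> F n \<subseteq> G \<and> (\<forall>g. g \<notin> F n \<longrightarrow> c n g = 0)
      \<and> (\<forall>x. s n x = (\<Sum>g\<in>F n. c n g * g x))"
    by (auto simp only: bchoice_iff)
  show ?thesis
  proof (rule that)
    show "finite (\<Union>n\<in>I. F n)" "(\<Union>n\<in>I. F n) \<subseteq> G"
      using assms(1) Fc by auto
    show "s n x = (\<Sum>g\<in>(\<Union>n\<in>I. F n). c n g * g x)" if "n \<in> I" for n x
    proof -
      have "(\<Sum>g\<in>F n. c n g * g x) = (\<Sum>g\<in>(\<Union>n\<in>I. F n). c n g * g x)"
        using assms(1) Fc that by (intro sum.mono_neutral_left) auto
      then show ?thesis using Fc that by simp
    qed
  qed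
qed

text \<open>Dividing by \<open>max g m\<close> keeps the quotient continuous. It is exact where
  \<open>g \<ge> m\<close>, which includes every point with \<open>\<bar>f y\<bar> \<ge> e\<close>;
  elsewhere multiplying back by \<open>g\<close> only shrinks \<open>f\<close>, so the error is at
  most \<open>\<bar>f y\<bar> < e\<close>.\<close>

lemma approximate_by_multiple:
  fixes f g :: "'a::t2_space \<Rightarrow> real"
  assumes K: "compact K" and f: "continuous_on K f" and g: "continuous_on K g"
    and nonneg: "\<And>y. y \<in> K \<Longrightarrow> 0 \<le> g y"
    and zero: "\<And>y. y \<in> K \<Longrightarrow> g y = 0 \<Longrightarrow> f y = 0"
    and "e > 0"
  obtains \<phi> where "continuous_on K \<phi>" "\<And>y. y \<in> K \<Longrightarrow> \<bar>f y - g y * \<phi> y\<bar> < e"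
proof -
  define A where "A = {y \<in> K. e \<le> \<bar>f y\<bar>}"
  obtain m where m: "m > 0" "\<And>y. y \<in> A \<Longrightarrow> m \<le> g y"
  proof (cases "A = {}")
    case True
    then show ?thesis using that[of 1] by simp
  next
    case False
    have "closed (K \<inter> (\<lambda>y. \<bar>f y\<bar>) -` {e..})"
      using K by (intro continuous_closed_preimage continuous_intros f compact_imp_closed) auto
    then have "compact (K \<inter> (K \<inter> (\<lambda>y. \<bar>f y\<bar>) -` {e..}))"
      by (rule compact_Int_closed[OF K])
    moreover have "K \<inter> (K \<inter> (\<lambda>y. \<bar>f y\<bar>) -` {e..}) = A"
      by (auto simp: A_def)
    ultimately have "compact A" by simp
    moreover have "continuous_on A g"
      by (rule continuous_on_subset[OF g]) (auto simp: A_def)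
    ultimately obtain y0 where y0: "y0 \<in> A" "\<forall>y\<in>A. g y0 \<le> g y"
      using continuous_attains_inf False by blast
    \<comment> \<open>A zero of \<open>g\<close> at \<open>y0\<close> would force
      \<open>f y0 = 0\<close>, contradicting \<open>e \<le> \<bar>f y0\<bar>\<close>.\<close>
    then have "g y0 \<noteq> 0" "g y0 \<ge> 0"
      using zero nonneg \<open>e > 0\<close> by (auto simp: A_def)
    then show ?thesis using that[of "g y0"] y0 by simp
  qed
  define \<phi> where "\<phi> y = f y / max (g y) m" for y
  show ?thesis
  proof (rule that)
    show "continuous_on K \<phi>"
      unfolding \<phi>_def using m(1) by (intro continuous_intros f g) auto
    show "\<bar>f y - g y * \<phi> y\<bar> < e" if "y \<in> K" for y
    proof (cases "y \<in> A")
      case True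
      then have "g y * \<phi> y = f y"
        using m by (force simp: \<phi>_def max_def)
      then show ?thesis using \<open>e > 0\<close> by simp
    next
      case False
      define q where "q = g y / max (g y) m"
      have q: "0 \<le> q" "q \<le> 1"
        using nonneg[OF that] m(1) by (auto simp: q_def divide_le_eq_1)
      have "f y - g y * \<phi> y = (1 - q) * f y"
        by (simp add: \<phi>_def q_def left_diff_distrib)
      then have "\<bar>f y - g y * \<phi> y\<bar> = (1 - q) * \<bar>f y\<bar>"
        using q by (simp add: abs_mult)
      also have "\<dots> \<le> \<bar>f y\<bar>"
        using q by (intro mult_left_le_one_le) auto
      also have "\<dots> < e"
        using False that by (simp add: A_def)
      finally show ?thesis .
    qed
  qed
qed

theorem corollary2p3:
  fixes \<sigma> :: "real \<Rightarrow> real"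
    and \<Omega> :: "(real ^ 'd) set"
    and N :: nat
    and u :: "nat \<Rightarrow> real ^ 'd \<Rightarrow> real"
    and g h :: "real ^ 'd \<Rightarrow> real"
    and \<epsilon> :: real
  assumes "continuous_on UNIV \<sigma>"
    and "\<not> (\<exists>P :: real poly. \<forall>x. \<sigma> x = poly P x)"
    and "open \<Omega>" and "bounded \<Omega>"
    and "\<And>n. n \<in> {1..N} \<Longrightarrow> continuous_on (closure \<Omega>) (u n)"
    and "continuous_on (closure \<Omega>) g"
    and "continuous_on (closure \<Omega>) h"
    and "\<And>n y. n \<in> {1..N} \<Longrightarrow> y \<in> frontier \<Omega> \<Longrightarrow> h y = u n y"
    and "\<And>y. y \<in> frontier \<Omega> \<Longrightarrow> g y = 0"
    and "\<And>y. y \<in> \<Omega> \<Longrightarrow> g y > 0"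
    and "\<epsilon> > 0"
  shows "\<exists>(p :: nat) (\<zeta> :: nat \<Rightarrow> real) (w :: nat \<Rightarrow> real ^ 'd) (\<beta> :: nat \<Rightarrow> nat \<Rightarrow> real).
           p \<ge> 1 \<and>
           (\<forall>n\<in>{1..N}. \<forall>y\<in>closure \<Omega>.
              \<bar>u n y - (h y + g y * (\<Sum>i=1..p. \<beta> n i * \<sigma> (w i \<bullet> y + \<zeta> i)))\<bar> < \<epsilon>)"
proof -
  define K where "K = closure \<Omega>"
  define G where "G = range (\<lambda>(w :: real ^ 'd, b) y. \<sigma> (w \<bullet> y + b))"
  have K: "compact K"
    using assms(4) by (simp add: K_def compact_closure)
  have cases_K: "y \<in> \<Omega> \<or> y \<in> frontier \<Omega>" if "y \<in> K" for y
    using that assms(3) by (auto simp: K_def frontier_def interior_open)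
  have nonneg: "0 \<le> g y" if "y \<in> K" for y
    using cases_K[OF that] assms(9,10) by force
  obtain B where B: "B > 0" "\<And>y. y \<in> K \<Longrightarrow> \<bar>g y\<bar> \<le> B"
    using compact_abs_bound[OF K] assms(6) unfolding K_def by blast
  have "\<exists>s\<in>fun_span G. \<forall>y\<in>K. \<bar>u n y - (h y + g y * s y)\<bar> < \<epsilon>" if n: "n \<in> {1..N}" for n
  proof -
    have "continuous_on K (\<lambda>y. u n y - h y)"
      using assms(5)[OF n] assms(7) unfolding K_def by (rule continuous_on_diff)
    \<comment> \<open>Positivity of \<open>g\<close> on \<open>\<Omega>\<close> places its zeros in
      \<open>K\<close> on the frontier, where \<open>h\<close> agrees with
      \<open>u n\<close>.\<close>
    moreover have "u n y - h y = 0" if "y \<in> K" "g y = 0" for y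
      using cases_K[OF that(1)] that(2) assms(8)[OF n, of y] assms(10)[of y] by auto
    ultimately obtain \<phi> where \<phi>: "continuous_on K \<phi>" "\<And>y. y \<in> K \<Longrightarrow> \<bar>u n y - h y - g y * \<phi> y\<bar> < \<epsilon> / 2"
      using approximate_by_multiple[OF K _ assms(6)[folded K_def] nonneg, of "\<lambda>y. u n y - h y" "\<epsilon> / 2"] assms(11)
      by auto
    \<comment> \<open>Multiplication by \<open>g\<close> enlarges the network error by at most
      \<open>B\<close>, leaving \<open>\<epsilon> / 2\<close> for it and
      \<open>\<epsilon> / 2\<close> for replacing \<open>u n - h\<close> by
      \<open>g * \<phi>\<close>.\<close>
    have "\<epsilon> / (2 * B) > 0" using assms(11) B(1) by simp
    then obtain s where s: "s \<in> fun_span G" "\<And>y. y \<in> K \<Longrightarrow> \<bar>\<phi> y - s y\<bar> < \<epsilon> / (2 * B)"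
      using approximableE[OF ridge_functions_dense[OF assms(1,2) K \<phi>(1)]] unfolding G_def by blast
    have "\<bar>u n y - (h y + g y * s y)\<bar> < \<epsilon>" if "y \<in> K" for y
    proof -
      have "\<bar>g y * (\<phi> y - s y)\<bar> \<le> B * \<bar>\<phi> y - s y\<bar>"
        unfolding abs_mult by (intro mult_right_mono B(2) that) auto
      also have "\<dots> < \<epsilon> / 2"
        using s(2)[OF that] B(1) by (simp add: field_simps)
      finally have "\<bar>g y * \<phi> y - g y * s y\<bar> < \<epsilon> / 2"
        by (simp only: right_diff_distrib)
      with \<phi>(2)[OF that] show ?thesis by linarith
    qed
    with s(1) show ?thesis by blast
  qed
  then obtain s where s: "\<And>n. n \<in> {1..N} \<Longrightarrow> s n \<in> fun_span G"
    "\<And>n y. n \<in> {1..N} \<Longrightarrow> y \<in> K \<Longrightarrow> \<bar>u n y - (h y + g y * s n y)\<bar> < \<epsilon>"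
    by metis
  obtain F c where F: "finite F" "F \<subseteq> G"
    and c: "\<And>n x. n \<in> {1..N} \<Longrightarrow> s n x = (\<Sum>\<gamma>\<in>F. c n \<gamma> * \<gamma> x)"
    using fun_span_common_finite[of "{1..N}" s G] s(1) by blast
  obtain \<gamma> where \<gamma>: "bij_betw \<gamma> {1..card F} F"
    using ex_bij_betw_nat_finite_1[OF F(1)] by blast
  \<comment> \<open>Members of \<open>F\<close> are functions, so a weight and a bias representing
    each must be chosen.\<close>
  have "\<forall>i\<in>{1..card F}. \<exists>w b. \<gamma> i = (\<lambda>y. \<sigma> (w \<bullet> y + b))"
    using bij_betwE[OF \<gamma>] F(2) unfolding G_def by fastforce
  then obtain w \<zeta> where w: "\<And>i. i \<in> {1..card F} \<Longrightarrow> \<gamma> i = (\<lambda>y. \<sigma> (w i \<bullet> y + \<zeta> i))"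
    by metis
  \<comment> \<open>\<open>F\<close> may be empty; one extra term with coefficient 0 guarantees \<open>p \<ge> 1\<close>.\<close>
  define \<beta> where "\<beta> n i = (if i \<le> card F then c n (\<gamma> i) else 0)" for n i
  have sum: "(\<Sum>i=1..Suc (card F). \<beta> n i * \<sigma> (w i \<bullet> y + \<zeta> i)) = s n y" if "n \<in> {1..N}" for n y
  proof -
    have "s n y = (\<Sum>i=1..card F. c n (\<gamma> i) * \<gamma> i y)"
      unfolding c[OF that] by (rule sum.reindex_bij_betw[OF \<gamma>, symmetric])
    also have "\<dots> = (\<Sum>i=1..card F. \<beta> n i * \<sigma> (w i \<bullet> y + \<zeta> i))"
      using w by (intro sum.cong) (auto simp: \<beta>_def)
    finally show ?thesis by (simp add: \<beta>_def)
  qed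
  show ?thesis
    using s(2) unfolding K_def
    by (intro exI[of _ "Suc (card F)"] exI[of _ \<zeta>] exI[of _ w] exI[of _ \<beta>]) (auto simp only: sum)
qed

end
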